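(* Let $X\in\mathfrak{sl}_n(\mathbb{C})$ be a nilpotent element, and let $\mathbf{d}\in\mathcal{P}(n)$ be the corresponding partition of $n$. Then $X$ is strongly real (with respect to $\mathrm{SL}_n(\mathbb{C})$) if and only if $\mathbf{d}\notin\widetilde{\mathcal{P}_e}(n)$.
   Context: For a Lie group $G$ with Lie algebra $\mathfrak{g}$, $X\in\mathfrak{g}$ is strongly real (strongly $\mathrm{Ad}_G$-real) if $-X=\mathrm{Ad}(\tau)X$ for some $\tau\in G$ with $\tau^2=\mathrm{Id}$. Here $G=\mathrm{SL}_n(\mathbb{C})$. $\mathcal{P}(n)$ is the set of partitions of $n$, written $\mathbf{d}=[d_1^{t_{d_1}},\dots,d_s^{t_{d_s}}]$ with $d_1>\dots>d_s>0$, $t_{d_i}\ge 1$, $\sum_i t_{d_i}d_i=n$. The partition corresponding to a nilpotent $X$ is given by its Jordan block sizes ($t_d$ is the number of Jordan blocks of size $d$). Put $\mathbb{N}_{\mathbf d}=\{d_1,\dots,d_s\}$, $\mathbb{E}_{\mathbf d}$ the set of even elements of $\mathbb{N}_{\mathbf d}$, and $\mathbb{E}^2_{\mathbf d}=\{\eta\in\mathbb{E}_{\mathbf d}\mid \eta\equiv 2 \pmod 4\}$. $\mathcal{P}_{\mathrm{even}}(n)$ is the set of $\mathbf d\in\mathcal P(n)$ with $\mathbb{N}_{\mathbf d}=\mathbb{E}_{\mathbf d}$ (all parts even); $\mathcal{P}_{\mathrm{v.even}}(n)$ is the subset of those $\mathbf d\in \mathcal{P}_{\mathrm{even}}(n)$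 for which $t_\eta$ is even for all $\eta\in\mathbb{N}_{\mathbf d}$. Finally $$\widetilde{\mathcal{P}_e}(n)=\Big\{\mathbf d\in\mathcal{P}_{\mathrm{even}}(n)\setminus\mathcal{P}_{\mathrm{v.even}}(n)\;\Big|\;\sum_{\eta\in\mathbb{E}^2_{\mathbf d}}t_\eta\ \text{is odd}\Big\}.$$ *)

theory Defs
  imports
    "Jordan_Normal_Form.Jordan_Normal_Form_Existence"
    "Jordan_Normal_Form.Jordan_Normal_Form_Uniqueness"
    "HOL-Library.Multiset"
begin

section \<open>The group \<open>SL\<^sub>n(\<complex>)\<close>, its Lie algebra and strong reality\<close>

definition SL :: "nat \<Rightarrow> complex mat monoid" where
  "SL n = \<lparr>carrier = {A \<in> carrier_mat n n. det A = 1}, mult = (*), one = 1\<^sub>m n\<rparr>"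

lemma group_SL: "group (SL n)"
proof (rule groupI)
  fix A assume "A \<in> carrier (SL n)"
  then have A: "A \<in> carrier_mat n n" and dA: "det A = 1"
    by (auto simp: SL_def)
  have inv: "adj_mat A \<in> carrier_mat n n" "A * adj_mat A = 1\<^sub>m n" "adj_mat A * A = 1\<^sub>m n"
    using adj_mat[OF A] dA by auto
  have "det (adj_mat A) = 1"
    using det_mult[OF A inv(1)] dA inv(2) by simp
  with inv show "\<exists>B\<in>carrier (SL n). B \<otimes>\<^bsub>SL n\<^esub> A = \<one>\<^bsub>SL n\<^esub>"
    by (auto simp: SL_def)
qed (auto simp: SL_def det_mult)

definition mat_trace :: "'a :: comm_monoid_add mat \<Rightarrow> 'a" where
  "mat_trace A = (\<Sum>i<dim_row A. A $$ (i, i))"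

definition sl :: "nat \<Rightarrow> complex mat set" where
  "sl n = {X \<in> carrier_mat n n. mat_trace X = 0}"

definition Ad :: "nat \<Rightarrow> complex mat \<Rightarrow> complex mat \<Rightarrow> complex mat" where
  "Ad n \<tau> X = \<tau> * X * inv\<^bsub>SL n\<^esub> \<tau>"

definition strongly_real :: "nat \<Rightarrow> complex mat \<Rightarrow> bool" where
  "strongly_real n X \<longleftrightarrow>
     (\<exists>\<tau>\<in>carrier (SL n). \<tau> [^]\<^bsub>SL n\<^esub> (2::nat) = \<one>\<^bsub>SL n\<^esub> \<and> - X = Ad n \<tau> X)"

definition nilpotent_mat :: "'a :: semiring_1 mat \<Rightarrow> bool" where
  "nilpotent_mat X \<longleftrightarrow> (\<exists>k. X ^\<^sub>m k = 0\<^sub>m (dim_row X) (dim_row X))"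

section \<open>Partitions\<close>

text \<open>
  A partition is the multiset of its parts, so the multiplicity \<open>t\<^sub>\<eta>\<close> of the part \<open>\<eta>\<close> in \<open>d\<close>
  is \<open>count d \<eta>\<close>, and \<open>\<nat>\<^sub>d = {d\<^sub>1, \<dots>, d\<^sub>s}\<close> is \<open>set_mset d\<close>.
\<close>

definition partitions :: "nat \<Rightarrow> nat multiset set" where
  "partitions n = {d. 0 \<notin># d \<and> sum_mset d = n}"

definition even_parts :: "nat multiset \<Rightarrow> nat set" where
  "even_parts d = {\<eta> \<in> set_mset d. even \<eta>}"

definition even2_parts :: "nat multiset \<Rightarrow> nat set" where
  "even2_parts d = {\<eta> \<in> even_parts d. \<eta> mod 4 = 2}"

definition even_partitions :: "nat \<Rightarrow> nat multiset set" where
  "even_partitions n = {d \<in> partitions n. set_mset d = even_parts d}"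

definition very_even_partitions :: "nat \<Rightarrow> nat multiset set" where
  "very_even_partitions n = {d \<in> even_partitions n. \<forall>\<eta>\<in>set_mset d. even (count d \<eta>)}"

text \<open>\<open>tilde_even_partitions n\<close> is the set written \<open>P\<^sub>e(n)\<close> with a tilde.\<close>

definition tilde_even_partitions :: "nat \<Rightarrow> nat multiset set" where
  "tilde_even_partitions n =
     {d \<in> even_partitions n - very_even_partitions n. odd (\<Sum>\<eta>\<in>even2_parts d. count d \<eta>)}"

text \<open>
  \<open>jordan_partition X d\<close>: the multiset of Jordan block sizes of \<open>X\<close> is \<open>d\<close>. The first
  components of the list in \<open>jordan_nf\<close> are the block sizes, the second ones the eigenvalues.
\<close>

definition jordan_partition :: "complex mat \<Rightarrow> nat multiset \<Rightarrow> bool" where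
  "jordan_partition X d \<longleftrightarrow> (\<exists>n_as. jordan_nf X n_as \<and> d = mset (map fst n_as))"

lemma jordan_nf_mset_unique:
  fixes X :: "complex mat"
  assumes a: "jordan_nf X n_as" and b: "jordan_nf X m_bs"
  shows "mset n_as = mset m_bs"
proof (rule multiset_eqI)
  fix x :: "nat \<times> complex"
  obtain k e where x: "x = (k, e)" by (cases x)
  show "count (mset n_as) x = count (mset m_bs) x"
  proof (cases "k = 0")
    case True
    then have "x \<notin> set n_as" "x \<notin> set m_bs"
      using a b imageI[of x _ fst] unfolding x jordan_nf_def by (metis fst_conv)+
    then show ?thesis
      by (metis count_mset_0_iff)
  next
    case False
    show ?thesis
      using compute_nr_of_jordan_blocks[OF a False, of e]
        compute_nr_of_jordan_blocks[OF b False, of e]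
      by (simp only: x count_mset count_list_eq_length_filter)
  qed
qed

lemma ex1_jordan_partition:
  assumes X: "X \<in> carrier_mat n n"
  shows "\<exists>!d. jordan_partition X d"
proof -
  obtain as where "char_poly X = (\<Prod>a\<leftarrow>as. [:- a, 1:])"
    using char_poly_factorized[OF X] by blast
  then obtain n_as where "jordan_nf X n_as"
    using jordan_nf_exists[OF X] by blast
  then show ?thesis
    unfolding jordan_partition_def mset_map by (auto dest: jordan_nf_mset_unique)
qed

lemma jordan_partition_partitions:
  assumes X: "X \<in> carrier_mat n n" and d: "jordan_partition X d"
  shows "d \<in> partitions n"
proof -
  obtain n_as where j: "jordan_nf X n_as" and d': "d = mset (map fst n_as)"
    using d by (auto simp: jordan_partition_def)
  have "dim_row X = dim_row (jordan_matrix n_as)"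
    using j similar_matD[of X "jordan_matrix n_as"] unfolding jordan_nf_def by fastforce
  then have "n = sum_list (map fst n_as)"
    using X by simp
  moreover have "0 \<notin># d"
    using j d' by (simp add: jordan_nf_def)
  ultimately show ?thesis
    unfolding partitions_def d' mem_Collect_eq sum_mset_sum_list by blast
qed

end

(* Strong reality asks for an involution \<tau> of determinant 1 that anticommutes with X, and X may be
   taken to be a Jordan matrix. Since n = \<Sum> t\<^sub>\<eta> \<eta>, the excluded partitions are those with all
   parts even and n \<equiv> 2 (mod 4).

   If all blocks are even, the positions 2i and 2i + 1 lie in the same block, and comparing the
   (2i, 2i + 1) entries of \<tau>X = -X\<tau> gives \<tau>_{2i+1,2i+1} = -\<tau>_{2i,2i}. So \<tau> has trace 0,
   its eigenvalues 1 and -1 are equally frequent, and det \<tau> = (-1)^(n/2).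
   Conversely, diagonal matrices with alternating signs on each block anticommute with X; their
   determinant is (-1)^(n/2) if all blocks are even, and an odd block allows it to be adjusted. *)
theory Submission
  imports Defs
begin

section \<open>Conjugation, trace and similarity\<close>

text \<open>The inner \<open>Q * P\<close> cancels. This carries both the involution identity and
  the anticommutation relation across a similarity.\<close>

lemma conj_mult_mat:
  fixes P :: "'a :: semiring_1 mat"
  assumes "P \<in> carrier_mat n n" "Q \<in> carrier_mat n n" "Q * P = 1\<^sub>m n"
    and "A \<in> carrier_mat n n" "B \<in> carrier_mat n n"
  shows "(P * A * Q) * (P * B * Q) = P * (A * B) * Q"
proof -
  have "(P * A * Q) * (P * B * Q) = P * A * ((Q * P) * (B * Q))"
    using assms(1,2,4,5) by (simp add: assoc_mult_mat[of _ n n _ n _ n])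
  also have "\<dots> = P * (A * B) * Q"
    unfolding assms(3) using assms(1,2,4,5) by (simp add: assoc_mult_mat[of _ n n _ n _ n])
  finally show ?thesis .
qed

lemma mat_trace_mult_comm:
  fixes A :: "'a :: comm_semiring_0 mat"
  assumes A: "A \<in> carrier_mat n m" and B: "B \<in> carrier_mat m n"
  shows "mat_trace (A * B) = mat_trace (B * A)"
proof -
  have "mat_trace (A * B) = (\<Sum>i<n. \<Sum>j<m. A $$ (i, j) * B $$ (j, i))"
    using A B by (auto simp: mat_trace_def scalar_prod_def atLeast0LessThan)
  also have "\<dots> = (\<Sum>j<m. \<Sum>i<n. B $$ (j, i) * A $$ (i, j))"
    by (subst sum.swap) (simp add: mult.commute)
  also have "\<dots> = mat_trace (B * A)"
    using A B by (auto simp: mat_trace_def scalar_prod_def atLeast0LessThan)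
  finally show ?thesis .
qed

lemma mat_trace_similar:
  fixes A :: "'a :: comm_semiring_1 mat"
  assumes "similar_mat A B"
  shows "mat_trace A = mat_trace B"
proof -
  obtain n P Q where car: "{A, B, P, Q} \<subseteq> carrier_mat n n"
    and PQ: "Q * P = 1\<^sub>m n" and A: "A = P * B * Q"
    using similar_matD[OF assms] by blast
  have "mat_trace A = mat_trace (Q * (P * B))"
    unfolding A using car by (intro mat_trace_mult_comm) auto
  also have "Q * (P * B) = B"
    using car PQ left_mult_one_mat[of B n n] by (simp flip: assoc_mult_mat[of _ n n _ n _ n])
  finally show ?thesis .
qed

lemma similar_mat_involution:
  fixes A :: "'a :: semiring_1 mat"
  assumes "similar_mat A B" and A: "A \<in> carrier_mat n n" and inv: "B * B = 1\<^sub>m n"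
  shows "A * A = 1\<^sub>m n"
proof -
  obtain P Q where wit: "similar_mat_wit A B P Q"
    using assms(1) by (auto simp: similar_mat_def)
  note w = similar_mat_witD2[OF A wit]
  show ?thesis
    unfolding w(3) conj_mult_mat[OF w(6,7,2) w(5) w(5)] inv using w by simp
qed

section \<open>Determinant of a traceless involution\<close>

text \<open>If m of the values are -1, the sum is n - 2m and the product is (-1)^m. A zero sum
  forces n = 2m, as the characteristic is 0.\<close>

lemma pm_one_sum_zero_prod:
  fixes f :: "nat \<Rightarrow> complex"
  assumes pm: "\<And>i. i < n \<Longrightarrow> f i = 1 \<or> f i = -1" and sum: "(\<Sum>i<n. f i) = 0"
  shows "(\<Prod>i<n. f i) = (-1) ^ (n div 2)"
proof -
  let ?S = "{i \<in> {..<n}. f i = -1}"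
  have eq: "f i = (if i \<in> ?S then -1 else 1)" if "i < n" for i
    using pm[OF that] that by auto
  have "(\<Sum>i<n. f i) = (\<Sum>i<n. 1 - (if i \<in> ?S then 2 else 0))"
    by (rule sum.cong) (use pm in fastforce)+
  also have "\<dots> = of_nat n - 2 * of_nat (card ?S)"
    by (simp add: sum_subtractf sum.If_cases Int_def conj_commute)
  finally have "of_nat n = (of_nat (2 * card ?S) :: complex)"
    using sum by simp
  then have n: "n = 2 * card ?S"
    by (simp only: of_nat_eq_iff)
  have "(\<Prod>i<n. f i) = (\<Prod>i<n. if i \<in> ?S then -1 else 1)"
    by (rule prod.cong) (use eq in auto)
  also have "\<dots> = (-1) ^ card ?S"
    by (simp add: prod.If_cases Int_def conj_commute)
  also have "card ?S = n div 2"
    using n by linarith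
  finally show ?thesis .
qed

text \<open>Schur triangularisation reduces the claim to the diagonal of \<open>T\<close>: its
  entries are 1 or -1, their sum is the trace and their product the determinant.\<close>

lemma det_traceless_involution:
  fixes A :: "complex mat"
  assumes A: "A \<in> carrier_mat n n" and inv: "A * A = 1\<^sub>m n" and tr: "mat_trace A = 0"
  shows "det A = (-1) ^ (n div 2)"
proof -
  obtain es where "char_poly A = (\<Prod>a\<leftarrow>es. [:- a, 1:])"
    using char_poly_factorized[OF A] by blast
  then obtain T where T: "T \<in> carrier_mat n n" and ut: "upper_triangular T"
    and sim: "similar_mat A T"
    using schur_decomposition_exists[OF A] by blast
  have TT: "T * T = 1\<^sub>m n"
    using similar_mat_involution[OF similar_mat_sym[OF sim] T inv] .
  have diag: "T $$ (i, i) = 1 \<or> T $$ (i, i) = -1" if i: "i < n" for i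
  proof -
    have "1 = (T * T) $$ (i, i)"
      using TT i by simp
    also have "\<dots> = (\<Sum>j<n. T $$ (i, j) * T $$ (j, i))"
      using T i by (simp add: scalar_prod_def atLeast0LessThan)
    \<comment> \<open>For j different from i, one of the two factors lies below the diagonal and
      vanishes.\<close>
    also have "\<dots> = (\<Sum>j<n. if j = i then T $$ (i, i) * T $$ (i, i) else 0)"
    proof (rule sum.cong)
      fix j assume "j \<in> {..<n}"
      then show "T $$ (i, j) * T $$ (j, i) = (if j = i then T $$ (i, i) * T $$ (i, i) else 0)"
        using upper_triangularD[OF ut, of j i] upper_triangularD[OF ut, of i j] T i
        by (cases j i rule: linorder_cases) auto
    qed simp
    also have "\<dots> = T $$ (i, i) * T $$ (i, i)"
      using i by simp
    finally show ?thesis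
      using square_eq_1_iff by metis
  qed
  have "det A = (\<Prod>i<n. T $$ (i, i))"
    using det_similar[OF sim] det_upper_triangular[OF ut T] T
    by (simp add: prod_list_diag_prod atLeast0LessThan)
  moreover have "(\<Sum>i<n. T $$ (i, i)) = 0"
    using mat_trace_similar[OF sim] tr T by (simp add: mat_trace_def)
  ultimately show ?thesis
    using pm_one_sum_zero_prod[of n "\<lambda>i. T $$ (i, i)"] diag by simp
qed

section \<open>Strong reality as an anticommutation condition\<close>

text \<open>An involution is its own inverse, so \<open>Ad n \<tau> X\<close> is
  \<open>\<tau> * X * \<tau>\<close>, and multiplying by \<tau> on the right moves the last factor
  to the other side.\<close>

lemma strongly_real_iff_anticommuting_involution:
  assumes X: "X \<in> carrier_mat n n"
  shows "strongly_real n X \<longleftrightarrow>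
    (\<exists>\<tau>\<in>carrier_mat n n. \<tau> * \<tau> = 1\<^sub>m n \<and> det \<tau> = 1 \<and> \<tau> * X = - (X * \<tau>))"
proof -
  interpret group "SL n"
    by (rule group_SL)
  have sq: "\<tau> [^]\<^bsub>SL n\<^esub> (2::nat) = \<tau> * \<tau>" if "\<tau> \<in> carrier (SL n)" for \<tau>
    using that by (simp add: numeral_2_eq_2) (simp add: SL_def)
  have "- X = Ad n \<tau> X \<longleftrightarrow> \<tau> * X = - (X * \<tau>)"
    if \<tau>: "\<tau> \<in> carrier (SL n)" and inv: "\<tau> * \<tau> = 1\<^sub>m n" for \<tau>
  proof -
    have car: "\<tau> \<in> carrier_mat n n"
      using \<tau> by (simp add: SL_def)
    have "inv\<^bsub>SL n\<^esub> \<tau> = \<tau>"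
      using inv_equality[of \<tau> \<tau>] \<tau> inv by (simp add: SL_def)
    then have Ad: "Ad n \<tau> X = \<tau> * X * \<tau>"
      by (simp add: Ad_def)
    have cancel: "M * \<tau> * \<tau> = M" if "M \<in> carrier_mat n n" for M
      using that car inv by (simp add: assoc_mult_mat[of _ n n _ n _ n])
    show ?thesis
    proof
      assume "- X = Ad n \<tau> X"
      then have "- X * \<tau> = \<tau> * X * \<tau> * \<tau>"
        using Ad by simp
      then show "\<tau> * X = - (X * \<tau>)"
        using cancel[of "\<tau> * X"] car X by simp
    next
      assume "\<tau> * X = - (X * \<tau>)"
      then have "\<tau> * X * \<tau> = - (X * \<tau> * \<tau>)"
        using car X by simp
      then show "- X = Ad n \<tau> X"
        using cancel[OF X] Ad by simp
    qed
  qed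
  then show ?thesis
    unfolding strongly_real_def using sq by (auto simp: SL_def)
qed

text \<open>The witness \<tau> for \<open>Y\<close> is conjugated along with \<open>Y\<close>. The
  matrix \<open>P\<close> may have any nonzero determinant, since conjugation by it preserves both
  the determinant of \<tau> and the identity \<open>\<tau> * \<tau> = 1\<^sub>m n\<close>.\<close>

lemma strongly_real_similar:
  assumes sim: "similar_mat X Y" and X: "X \<in> carrier_mat n n" and real: "strongly_real n Y"
  shows "strongly_real n X"
proof -
  obtain P Q where wit: "similar_mat_wit X Y P Q"
    using sim by (auto simp: similar_mat_def)
  note w = similar_mat_witD2[OF X wit]
  obtain \<tau> where \<tau>: "\<tau> \<in> carrier_mat n n" "\<tau> * \<tau> = 1\<^sub>m n" "det \<tau> = 1"
    and anti: "\<tau> * Y = - (Y * \<tau>)"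
    using real w(5) by (auto simp: strongly_real_iff_anticommuting_involution)
  let ?\<sigma> = "P * \<tau> * Q"
  have \<sigma>: "?\<sigma> \<in> carrier_mat n n"
    using w \<tau> by simp
  have sim\<sigma>: "similar_mat ?\<sigma> \<tau>"
    using w \<tau> by (intro similar_matI[of _ _ P Q n]) auto
  have "?\<sigma> * X = P * (\<tau> * Y) * Q"
    unfolding w(3) using conj_mult_mat[OF w(6,7,2) \<tau>(1) w(5)] .
  also have "\<dots> = - (P * (Y * \<tau>) * Q)"
    unfolding anti using w(5-7) \<tau>(1) by simp
  also have "P * (Y * \<tau>) * Q = X * ?\<sigma>"
    unfolding w(3) using conj_mult_mat[OF w(6,7,2) w(5) \<tau>(1)] by simp
  finally show ?thesis
    unfolding strongly_real_iff_anticommuting_involution[OF X]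
    using \<sigma> similar_mat_involution[OF sim\<sigma> \<sigma> \<tau>(2)] det_similar[OF sim\<sigma>] \<tau>(3) by auto
qed

section \<open>Obstruction from even blocks\<close>

text \<open>Every block starts at an even index and ends at an odd one. So an even row is never the
  last of its block and an odd column never the first, and the superdiagonal entry there is
  1.\<close>

lemma jordan_matrix_even_blocks:
  fixes n_as :: "(nat \<times> complex) list"
  assumes "\<And>k a. (k, a) \<in> set n_as \<Longrightarrow> even k \<and> a = 0"
    and "i < sum_list (map fst n_as)" "j < sum_list (map fst n_as)"
  shows "even i \<Longrightarrow> jordan_matrix n_as $$ (i, j) = of_bool (j = Suc i)"
    and "odd j \<Longrightarrow> jordan_matrix n_as $$ (i, j) = of_bool (j = Suc i)"
proof -
  have "even i \<or> odd j \<Longrightarrow> jordan_matrix n_as $$ (i, j) = of_bool (j = Suc i)"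
    using assms
  proof (induction n_as arbitrary: i j)
    case (Cons ka n_as)
    obtain k where ka: "ka = (k, 0)" and k: "even k"
      using Cons.prems(2)[of "fst ka" "snd ka"] by (cases ka) auto
    consider "i < k" "j < k" | "i < k" "k \<le> j" | "k \<le> i" "j < k" | "k \<le> i" "k \<le> j"
      by linarith
    then show ?case
    proof cases
      case 4
      have "jordan_matrix n_as $$ (i - k, j - k) = of_bool (j - k = Suc (i - k))"
        using Cons.prems k 4 ka by (intro Cons.IH) auto
      then show ?thesis
        using 4 Cons.prems(3,4) unfolding ka by (auto simp: jordan_matrix_Cons)
    next
      case 2
      \<comment> \<open>Otherwise i = k - 1 and j = k, so i is odd and j is even, against the parity
        assumption.\<close>
      have "j \<noteq> Suc i"
        using 2 Cons.prems(1) k by (auto simp: le_Suc_eq)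
      then show ?thesis
        using 2 Cons.prems(3,4) unfolding ka by (auto simp: jordan_matrix_Cons)
    qed (use Cons.prems(1,3,4) ka in \<open>auto simp: jordan_matrix_Cons\<close>)
  qed simp
  then show "even i \<Longrightarrow> jordan_matrix n_as $$ (i, j) = of_bool (j = Suc i)"
    and "odd j \<Longrightarrow> jordan_matrix n_as $$ (i, j) = of_bool (j = Suc i)"
    by auto
qed

text \<open>Column 2i + 1 of the Jordan matrix has its only nonzero entry in row 2i, and conversely.
  Hence the (2i, 2i + 1) entry of either product is a single diagonal entry of \<tau>, and the
  diagonal cancels in consecutive pairs.\<close>

lemma mat_trace_anticommuting_even_blocks:
  fixes n_as :: "(nat \<times> complex) list"
  defines "n \<equiv> sum_list (map fst n_as)"
  assumes even: "\<And>k a. (k, a) \<in> set n_as \<Longrightarrow> even k \<and> a = 0"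
    and \<tau>: "\<tau> \<in> carrier_mat n n"
    and anti: "\<tau> * jordan_matrix n_as = - (jordan_matrix n_as * \<tau>)"
  shows "mat_trace \<tau> = 0"
proof -
  let ?J = "jordan_matrix n_as"
  have J: "?J \<in> carrier_mat n n"
    by (rule carrier_matI) (simp_all add: n_def)
  have "even n"
    unfolding n_def using even by (induction n_as) fastforce+
  then obtain m where m: "n = 2 * m"
    by blast
  have pair: "\<tau> $$ (2 * i, 2 * i) + \<tau> $$ (Suc (2 * i), Suc (2 * i)) = 0" if "i < m" for i
  proof -
    have lt: "2 * i < n" "Suc (2 * i) < n"
      using that m by auto
    have "(\<tau> * ?J) $$ (2 * i, Suc (2 * i)) = (\<Sum>k<n. \<tau> $$ (2 * i, k) * of_bool (k = 2 * i))"
      using \<tau> J lt jordan_matrix_even_blocks(2)[OF even, of n_as]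
      by (auto simp: scalar_prod_def atLeast0LessThan n_def intro!: sum.cong)
    also have "\<dots> = \<tau> $$ (2 * i, 2 * i)"
      using lt by (simp add: of_bool_def if_distrib[of "(*) _"] cong: if_cong)
    finally have 1: "(\<tau> * ?J) $$ (2 * i, Suc (2 * i)) = \<tau> $$ (2 * i, 2 * i)" .
    have "(?J * \<tau>) $$ (2 * i, Suc (2 * i))
        = (\<Sum>k<n. of_bool (k = Suc (2 * i)) * \<tau> $$ (k, Suc (2 * i)))"
      using \<tau> J lt jordan_matrix_even_blocks(1)[OF even, of n_as]
      by (auto simp: scalar_prod_def atLeast0LessThan n_def intro!: sum.cong)
    also have "\<dots> = \<tau> $$ (Suc (2 * i), Suc (2 * i))"
      using lt by (simp add: of_bool_def if_distrib[of "\<lambda>x. x * _"] cong: if_cong)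
    finally show ?thesis
      using 1 anti carrier_matD[OF \<tau>] carrier_matD[OF J] lt
      by (simp add: minus_equation_iff add_eq_0_iff)
  qed
  have "mat_trace \<tau> = (\<Sum>i<2 * m. \<tau> $$ (i, i))"
    using \<tau> m by (simp add: mat_trace_def)
  also have "\<dots> = (\<Sum>i<m. \<tau> $$ (2 * i, 2 * i) + \<tau> $$ (Suc (2 * i), Suc (2 * i)))"
    by (induction m) (simp_all add: algebra_simps)
  also have "\<dots> = 0"
    using pair by simp
  finally show ?thesis .
qed

section \<open>Sign functions on Jordan matrices\<close>

text \<open>The exponents add up to k(k - 1)/2, which has the parity of
  \<open>k div 2\<close>.\<close>

lemma prod_alternating:
  "(\<Prod>i<k. (-1) ^ i) = ((-1) ^ (k div 2) :: 'a :: comm_ring_1)"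
proof (induction k)
  case (Suc k)
  then show ?case
    by (cases "even k") (auto elim!: evenE oddE simp flip: power_add)
qed simp

text \<open>
  On a single block the signs alternate, up to a global sign; changing that global sign
  changes the product exactly when the block has odd size.
\<close>

lemma jordan_matrix_sign_function:
  fixes n_as :: "(nat \<times> complex) list" and c :: complex
  defines "n \<equiv> sum_list (map fst n_as)"
  assumes "\<And>k a. (k, a) \<in> set n_as \<Longrightarrow> a = 0" and "c = 1 \<or> c = -1"
    and "(\<forall>k\<in>fst ` set n_as. even k) \<Longrightarrow> c = (-1) ^ (n div 2)"
  obtains f where "\<And>i. i < n \<Longrightarrow> f i * f i = 1"
    and "\<And>i j. i < n \<Longrightarrow> j < n \<Longrightarrow> jordan_matrix n_as $$ (i, j) \<noteq> 0 \<Longrightarrow> f i = - f j"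
    and "(\<Prod>i<n. f i) = c"
proof -
  have "\<exists>f. (\<forall>i<n. f i * f i = 1) \<and>
      (\<forall>i<n. \<forall>j<n. jordan_matrix n_as $$ (i, j) \<noteq> 0 \<longrightarrow> f i = - f j) \<and> (\<Prod>i<n. f i) = c"
    using assms(2-4) unfolding n_def
  proof (induction n_as arbitrary: c)
    case (Cons ka n_as)
    obtain k where ka: "ka = (k, 0)"
      using Cons.prems(1)[of "fst ka" "snd ka"] by (cases ka) auto
    define m where "m = sum_list (map fst n_as)"
    \<comment> \<open>The product over all blocks will be \<open>s ^ k * e * c'\<close>:
      \<open>e\<close> comes from the alternating signs of the first block, \<open>s\<close> is its
      global sign, and \<open>c'\<close> is the target for the tail. If the tail has only even
      blocks, \<open>c'\<close> is forced; otherwise it is chosen to make \<open>s\<close> equal to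
      1.\<close>
    define e where "e = ((-1) ^ (k div 2) :: complex)"
    define c' where "c' = (if \<forall>k\<in>fst ` set n_as. even k then (-1) ^ (m div 2) else c * e)"
    define s where "s = c * c' * e"
    have pm: "c * c = 1" "e * e = 1" "c' = 1 \<or> c' = -1"
      using Cons.prems(2) unfolding c'_def e_def
      by (auto simp: minus_one_power_iff)
    then have c'c': "c' * c' = 1"
      by auto
    have ss: "s * s = 1"
    proof -
      have "s * s = (c * c) * (c' * c') * (e * e)"
        by (simp add: s_def ac_simps)
      then show ?thesis
        using pm c'c' by simp
    qed
    \<comment> \<open>The global sign of an even block drops out of the product, so it must be 1 for
      \<open>s ^ k = s\<close>. With an even tail as well, this is the hypothesis on
      \<open>c\<close>.\<close>
    have "s = 1" if "even k"
    proof (cases "\<forall>k\<in>fst ` set n_as. even k")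
      case True
      then have "even m"
        unfolding m_def by (induction n_as) auto
      have "c = (-1) ^ ((k + m) div 2)"
        using Cons.prems(3) True that ka m_def by simp
      also have "\<dots> = e * c'"
        using that \<open>even m\<close> True by (auto simp: e_def c'_def power_add elim!: evenE)
      finally have "s = (c' * c') * (e * e)"
        by (simp add: s_def ac_simps)
      then show ?thesis
        using pm c'c' by simp
    next
      case False
      then have "s = (c * c) * (e * e)"
        by (simp only: s_def c'_def if_False ac_simps)
      then show ?thesis
        using pm by simp
    qed
    moreover have "s ^ k = s" if "odd k"
    proof -
      obtain l where "k = 2 * l + 1"
        using \<open>odd k\<close> by (rule oddE)
      then show ?thesis
        using ss by (simp add: power_mult power2_eq_square)
    qed
    ultimately have s: "s ^ k = s"
      by (cases "even k") auto
    obtain f where f: "\<And>i. i < m \<Longrightarrow> f i * f i = 1"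
      "\<And>i j. i < m \<Longrightarrow> j < m \<Longrightarrow> jordan_matrix n_as $$ (i, j) \<noteq> 0 \<Longrightarrow> f i = - f j"
      "(\<Prod>i<m. f i) = c'"
      using Cons.IH[of c'] Cons.prems(1) pm(3) unfolding m_def[symmetric] c'_def by force
    \<comment> \<open>No nonzero entry joins two blocks, so the first block and the tail can be
      signed independently.\<close>
    define g where "g i = (if i < k then s * (-1) ^ i else f (i - k))" for i
    have "g i * g i = 1" if "i < k + m" for i
    proof (cases "i < k")
      case True
      have "g i * g i = (s * s) * ((-1) ^ i * (-1) ^ i)"
        using True by (simp add: g_def ac_simps)
      then show ?thesis
        using ss by (simp flip: power_mult_distrib)
    qed (use f(1)[of "i - k"] that in \<open>auto simp: g_def\<close>)
    moreover have "g i = - g j"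
      if "i < k + m" "j < k + m" "jordan_matrix (ka # n_as) $$ (i, j) \<noteq> 0" for i j
      using that f(2)[of "i - k" "j - k"] unfolding ka
      by (auto simp: jordan_matrix_Cons g_def m_def split: if_splits)
    moreover have "(\<Prod>i<k + m. g i) = c"
    proof -
      have "(\<Prod>i<k + m. g i) = (\<Prod>i<k. g i) * (\<Prod>i<m. g (k + i))"
        by (induction m) (simp_all add: ac_simps)
      also have "\<dots> = s ^ k * e * c'"
        using f(3) by (simp add: g_def prod.distrib prod_alternating e_def)
      also have "\<dots> = c * (c' * c') * (e * e)"
        by (simp add: s) (simp add: s_def ac_simps)
      finally show ?thesis
        using pm c'c' by simp
    qed
    ultimately show ?case
      unfolding ka list.map fst_conv sum_list.Cons m_def by blast
  qed simp
  then show ?thesis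
    using that by blast
qed

section \<open>Eigenvalues of nilpotent matrices\<close>

lemma nilpotent_mat_eigenvalue:
  fixes X :: "'a :: field mat"
  assumes X: "X \<in> carrier_mat n n" and nil: "nilpotent_mat X" and ev: "eigenvalue X a"
  shows "a = 0"
proof (rule ccontr)
  assume a: "a \<noteq> 0"
  obtain v where v: "eigenvector X v a"
    using ev by (auto simp: eigenvalue_def)
  then have vc: "v \<in> carrier_vec n" "v \<noteq> 0\<^sub>v n"
    using X by (auto simp: eigenvector_def)
  obtain k where "X ^\<^sub>m k = 0\<^sub>m n n"
    using nil X by (auto simp: nilpotent_mat_def)
  moreover have "0\<^sub>m n n *\<^sub>v v = 0\<^sub>v n"
    using vc(1) by (intro eq_vecI) auto
  ultimately have zero: "a ^ k \<cdot>\<^sub>v v = 0\<^sub>v n"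
    using eigenvector_pow[OF X v, of k] by simp
  have "v $ i = 0" if "i < n" for i
    using arg_cong[OF zero, of "\<lambda>w. w $ i"] that vc a by simp
  then show False
    using vc by auto
qed

text \<open>Blocks of a Jordan normal form are nonempty, so the linear factor of \<open>a\<close>
  divides the characteristic polynomial and \<open>a\<close> is an eigenvalue.\<close>

lemma nilpotent_jordan_nf_eigenvalues:
  fixes X :: "'a :: field mat"
  assumes X: "X \<in> carrier_mat n n" and nil: "nilpotent_mat X" and jnf: "jordan_nf X n_as"
    and ka: "(k, a) \<in> set n_as"
  shows "a = 0"
proof -
  have "k \<noteq> 0"
    using jnf ka by (force simp: jordan_nf_def)
  then have "[:- a, 1:] dvd [:- a, 1:] ^ k"
    by (simp add: dvd_power)
  also have "\<dots> dvd char_poly X"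
    unfolding jordan_nf_char_poly[OF jnf] using ka by (induction n_as) auto
  finally have "eigenvalue X a"
    by (simp add: eigenvalue_root_char_poly[OF X] poly_eq_0_iff_dvd)
  then show ?thesis
    using nilpotent_mat_eigenvalue[OF X nil] by simp
qed

section \<open>The criterion on Jordan matrices and on partitions\<close>

lemma strongly_real_jordan_matrix_iff:
  fixes n_as :: "(nat \<times> complex) list"
  defines "n \<equiv> sum_list (map fst n_as)"
  assumes zero: "\<And>k a. (k, a) \<in> set n_as \<Longrightarrow> a = 0"
  shows "strongly_real n (jordan_matrix n_as) \<longleftrightarrow>
    \<not> ((\<forall>k\<in>fst ` set n_as. even k) \<and> odd (n div 2))"
proof
  let ?J = "jordan_matrix n_as"
  have J: "?J \<in> carrier_mat n n"
    by (rule carrier_matI) (simp_all add: n_def)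
  note iff = strongly_real_iff_anticommuting_involution[OF J]
  {
    assume "strongly_real n ?J"
    then obtain \<tau> where \<tau>: "\<tau> \<in> carrier_mat n n" "\<tau> * \<tau> = 1\<^sub>m n" "det \<tau> = 1"
      and anti: "\<tau> * ?J = - (?J * \<tau>)"
      unfolding iff by blast
    show "\<not> ((\<forall>k\<in>fst ` set n_as. even k) \<and> odd (n div 2))"
    proof
      assume ev: "(\<forall>k\<in>fst ` set n_as. even k) \<and> odd (n div 2)"
      then have "mat_trace \<tau> = 0"
        using zero \<tau>(1) anti unfolding n_def
        by (intro mat_trace_anticommuting_even_blocks) force+
      then show False
        using det_traceless_involution[OF \<tau>(1,2)] \<tau>(3) ev by simp
    qed
  }
  assume "\<not> ((\<forall>k\<in>fst ` set n_as. even k) \<and> odd (n div 2))"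
  \<comment> \<open>For the target determinant 1, the condition on sign functions is the negation of
    the obstruction.\<close>
  then have one: "(\<forall>k\<in>fst ` set n_as. even k) \<Longrightarrow> (1 :: complex) = (-1) ^ (n div 2)"
    by auto
  obtain f :: "nat \<Rightarrow> complex" where f: "\<And>i. i < n \<Longrightarrow> f i * f i = 1"
    "\<And>i j. i < n \<Longrightarrow> j < n \<Longrightarrow> ?J $$ (i, j) \<noteq> 0 \<Longrightarrow> f i = - f j" "(\<Prod>i<n. f i) = 1"
    by (rule jordan_matrix_sign_function[where n_as = n_as and c = 1, folded n_def])
      (blast intro: zero one)+
  let ?D = "mat_diag n f"
  have D: "?D \<in> carrier_mat n n"
    by simp
  have "?D * ?D = 1\<^sub>m n"
    unfolding mat_diag_diag by (rule eq_matI) (use f(1) in \<open>auto simp: mat_diag_def\<close>)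
  moreover have "det ?D = 1"
  proof -
    have "det ?D = prod_list (diag_mat ?D)"
      by (rule det_upper_triangular[OF _ D]) (auto simp: mat_diag_def)
    also have "\<dots> = (\<Prod>i<n. f i)"
      by (simp add: prod_list_diag_prod atLeast0LessThan mat_diag_def)
    finally show ?thesis
      using f(3) by simp
  qed
  \<comment> \<open>The (i, j) entries of the two products are \<open>?J $$ (i, j)\<close> scaled by
    \<open>f i\<close> and by \<open>f j\<close>.\<close>
  moreover have "?D * ?J = - (?J * ?D)"
    unfolding mat_diag_mult_left[OF J] mat_diag_mult_right[OF J]
    using f(2) by (intro eq_matI) fastforce+
  ultimately show "strongly_real n ?J"
    unfolding iff using D by blast
qed

text \<open>A part 2l contributes l to n/2, and l is odd exactly when 2l is 2 modulo 4. So the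
  number of such parts, with multiplicity, has the parity of n/2.\<close>

lemma tilde_even_partitions_iff:
  assumes d: "d \<in> partitions n"
  shows "d \<in> tilde_even_partitions n \<longleftrightarrow> (\<forall>k\<in>#d. even k) \<and> odd (n div 2)"
proof -
  let ?s = "\<Sum>\<eta>\<in>even2_parts d. count d \<eta>"
  have even: "d \<in> even_partitions n \<longleftrightarrow> (\<forall>k\<in>#d. even k)"
    using d by (auto simp: even_partitions_def even_parts_def)
  have very: "even ?s" if "d \<in> very_even_partitions n"
    using that by (intro dvd_sum) (auto simp: very_even_partitions_def even2_parts_def even_parts_def)
  have "odd ?s \<longleftrightarrow> odd (n div 2)" if ev: "\<forall>k\<in>#d. even k"
  proof -
    \<comment> \<open>As the size of a filtered multiset, the sum of multiplicities is open to
      induction on \<open>d\<close>.\<close>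
    let ?F = "{#\<eta> \<in># d. \<eta> mod 4 = 2#}"
    have "even2_parts d = set_mset ?F"
      using ev by (auto simp: even2_parts_def even_parts_def)
    then have "?s = size ?F"
      by (simp add: size_multiset_overloaded_eq)
    moreover have "odd (size {#\<eta> \<in># d. \<eta> mod 4 = 2#}) \<longleftrightarrow> odd (sum_mset d div 2)"
      using ev
    proof (induction d)
      case (add k d)
      have "even (sum_mset d)"
        using add.prems by (induction d) auto
      moreover obtain l where "k = 2 * l"
        using add.prems by auto
      moreover have "2 * l mod 4 = 2 \<longleftrightarrow> odd l"
        by presburger
      ultimately show ?case
        using add by (auto elim!: evenE)
    qed simp
    ultimately show ?thesis
      using d by (simp add: partitions_def)
  qed
  then show ?thesis
    using even very unfolding tilde_even_partitions_def by auto
qed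

theorem theorem4p6:
  fixes n :: nat and X :: "complex mat" and d :: "nat multiset"
  assumes "X \<in> sl n" and "nilpotent_mat X"
    and "d \<in> partitions n" and "jordan_partition X d"
  shows "strongly_real n X \<longleftrightarrow> d \<notin> tilde_even_partitions n"
proof -
  have X: "X \<in> carrier_mat n n"
    using assms(1) by (simp add: sl_def)
  obtain n_as where jnf: "jordan_nf X n_as" and d: "d = mset (map fst n_as)"
    using assms(4) by (auto simp: jordan_partition_def)
  have n: "n = sum_list (map fst n_as)"
    using assms(3) unfolding partitions_def d mem_Collect_eq sum_mset_sum_list by simp
  let ?J = "jordan_matrix n_as"
  have J: "?J \<in> carrier_mat n n"
    by (rule carrier_matI) (simp_all add: n)
  have sim: "similar_mat X ?J"
    using jnf by (simp add: jordan_nf_def)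
  have "strongly_real n X \<longleftrightarrow> strongly_real n ?J"
    using strongly_real_similar[OF sim X] strongly_real_similar[OF similar_mat_sym[OF sim] J]
    by blast
  also have "\<dots> \<longleftrightarrow> \<not> ((\<forall>k\<in>fst ` set n_as. even k) \<and> odd (n div 2))"
    unfolding n using nilpotent_jordan_nf_eigenvalues[OF X assms(2) jnf]
    by (rule strongly_real_jordan_matrix_iff)
  also have "\<dots> \<longleftrightarrow> d \<notin> tilde_even_partitions n"
    using tilde_even_partitions_iff[OF assms(3)] by (simp add: d)
  finally show ?thesis .
qed

end
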